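(* For every integer $n \ge 3$, \[ d(n,3) = \begin{cases} \left\lfloor \frac{4n}{7}\right\rfloor & \text{ if } n \equiv 3,5 \pmod {7},\\ \left\lfloor \frac{4n}{7}\right\rfloor-1& \text{ otherwise.} \end{cases} \]
   Context: All codes are binary linear codes. An $[n,k]$ code is a $k$-dimensional subspace of $\mathbb{F}_2^n$; an $[n,k,d]$ code is one with minimum nonzero Hamming weight $d$. The dual $C^\perp$ is taken with respect to the standard inner product. A code $C$ is LCD (linear complementary dual) if $C \cap C^\perp = \{\mathbf{0}_n\}$. $d(n,k)$ denotes the largest minimum weight among all binary LCD $[n,k]$ codes. *)

theory Defs
  imports "Jordan_Normal_Form.VS_Connect" "HOL-Library.Z2"
begin

definition binary_code :: "nat \<Rightarrow> nat \<Rightarrow> bit vec set \<Rightarrow> bool" where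
  "binary_code n k C \<longleftrightarrow>
     VectorSpace.subspace class_ring C (module_vec TYPE(bit) n) \<and>
     vectorspace.dim class_ring ((module_vec TYPE(bit) n)\<lparr>carrier := C\<rparr>) = k"

definition LCD :: "nat \<Rightarrow> bit vec set \<Rightarrow> bool" where
  "LCD n C \<longleftrightarrow> C \<inter> vec_module.orthogonal_complement n C = {0\<^sub>v n}"

definition hamming_weight :: "bit vec \<Rightarrow> nat" where
  "hamming_weight v = card {i. i < dim_vec v \<and> v $ i \<noteq> 0}"

definition min_weight :: "nat \<Rightarrow> bit vec set \<Rightarrow> nat" where
  "min_weight n C = Min (hamming_weight ` (C - {0\<^sub>v n}))"

text \<open>
  The maximum ranges over a finite set, since every minimum weight is at most \<open>n\<close> when
  \<open>k \<ge> 1\<close>; this set is nonempty for \<open>1 \<le> k \<le> n\<close>, as appending \<open>n - k\<close> zero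
  coordinates to all words of length \<open>k\<close> gives an LCD code. Outside that range the value
  carries no meaning.
\<close>

definition max_LCD_weight :: "nat \<Rightarrow> nat \<Rightarrow> nat" where
  "max_LCD_weight n k = Max {min_weight n C | C. binary_code n k C \<and> LCD n C}"

end

theory Submission
  imports Defs
begin

text \<open>
  The seven nonzero words of a three-dimensional code have total weight at most \<open>4n\<close>, since each
  coordinate is nonzero on four of them or on none. If the code is LCD, the inner product is
  nondegenerate on a space of odd dimension, so it is not alternating, and exactly four words have
  odd weight. Since weights of the wrong parity must exceed the minimum weight, counting gives the
  upper bound for all residues of \<open>n\<close> modulo \<open>7\<close> except \<open>1\<close> and \<open>6\<close>; there the three
  nonzero even words would all have the same weight divisible by \<open>4\<close>, hence span a totally
  isotropic plane, which a nondegenerate form in dimension three does not admit.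

  For the lower bound, appending a zero coordinate or a copy of the (self-orthogonal, constant
  weight \<open>4\<close>) simplex code of length \<open>7\<close> preserves all inner products, so codes of lengths
  \<open>3, 5, 7, 9\<close> suffice.
\<close>

text \<open>These rules turn field operations on bits into bit operations, so that facts about
  \<^const>\<open>class_ring\<close> and vectors no longer apply.\<close>

declare add_bit_eq_xor [simp del] mult_bit_eq_and [simp del]

section \<open>Arithmetic of bit vectors\<close>

lemma UNIV_bit: "(UNIV :: bit set) = {0, 1}"
  by (auto intro: bit.exhaust)

lemma card_UNIV_bit: "card (UNIV :: bit set) = 2"
  by (simp add: UNIV_bit)

lemma finite_carrier_vec_bit: "finite (carrier_vec n :: bit vec set)"
proof (rule finite_subset)
  show "carrier_vec n \<subseteq> vec_of_list ` {xs :: bit list. set xs \<subseteq> UNIV \<and> length xs = n}"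
  proof
    fix v :: "bit vec"
    assume "v \<in> carrier_vec n"
    then show "v \<in> vec_of_list ` {xs. set xs \<subseteq> UNIV \<and> length xs = n}"
      by (intro image_eqI[of _ _ "list_of_vec v"]) (simp_all add: vec_list)
  qed
  show "finite (vec_of_list ` {xs :: bit list. set xs \<subseteq> UNIV \<and> length xs = n})"
    by (intro finite_imageI finite_lists_length_eq) (simp add: UNIV_bit)
qed

lemma bit_vec_add_self: "x \<in> carrier_vec n \<Longrightarrow> x + x = (0\<^sub>v n :: bit vec)"
  by (rule eq_vecI) auto

lemma bit_vec_add_left_self:
  "x \<in> carrier_vec n \<Longrightarrow> y \<in> carrier_vec n \<Longrightarrow> x + (x + y) = (y :: bit vec)"
  by (rule eq_vecI) (auto simp flip: add.assoc)

lemma vec_add_left_commute: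
  "x \<in> carrier_vec n \<Longrightarrow> y \<in> carrier_vec n \<Longrightarrow> z \<in> carrier_vec n \<Longrightarrow>
    x + (y + z) = y + (x + (z :: 'a :: comm_monoid_add vec))"
  by (rule eq_vecI) (auto simp: add.left_commute)

text \<open>Ordered rewriting brings equal summands together, and cancellation removes them in
  pairs.\<close>

lemmas bit_vec_ac = comm_add_vec[where n = n] assoc_add_vec[where n = n]
  vec_add_left_commute[where n = n] bit_vec_add_self[where n = n]
  bit_vec_add_left_self[where n = n] for n

section \<open>Subspaces over the two-element field\<close>

text \<open>The only scalars are 0 and 1, so this is the scalar-free form of a linear
  subspace.\<close>

definition add_closed_code :: "nat \<Rightarrow> bit vec set \<Rightarrow> bool" where
  "add_closed_code n C \<longleftrightarrow> C \<subseteq> carrier_vec n \<and> 0\<^sub>v n \<in> C \<and> (\<forall>u\<in>C. \<forall>v\<in>C. u + v \<in> C)"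

lemma subspace_bit_iff:
  "VectorSpace.subspace class_ring C (module_vec TYPE(bit) n) \<longleftrightarrow> add_closed_code n C"
proof
  interpret vec_space "TYPE(bit)" n .
  show "VectorSpace.subspace class_ring C V" if "add_closed_code n C"
  proof -
    have "c \<cdot>\<^sub>v v \<in> C" if "v \<in> C" for c v
    proof (cases "c = 0")
      case True
      have "0 \<cdot>\<^sub>v v = 0\<^sub>v n"
        using that \<open>add_closed_code n C\<close> by (auto simp: add_closed_code_def intro!: eq_vecI)
      then show ?thesis
        using True \<open>add_closed_code n C\<close> by (simp add: add_closed_code_def)
    next
      case False
      then show ?thesis using that by simp
    qed
    then show ?thesis
      using that vectorspace_axioms vec_module
      by (auto simp: add_closed_code_def VectorSpace.subspace_def LinearCombinations.submodule_def
          module_vec_simps)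
  qed
  show "add_closed_code n C" if "VectorSpace.subspace class_ring C V"
    using that
    by (auto simp: add_closed_code_def VectorSpace.subspace_def LinearCombinations.submodule_def
        module_vec_simps)
qed

text \<open>Coordinates identify \<open>C\<close> with the bit-valued functions on a basis.
  Dimension three can thus be replaced by cardinality eight.\<close>

lemma card_bit_subspace:
  assumes "add_closed_code n C"
  shows "card C = 2 ^ vectorspace.dim class_ring ((module_vec TYPE(bit) n)\<lparr>carrier := C\<rparr>)"
proof -
  interpret V: vec_space "TYPE(bit)" n .
  let ?W = "(module_vec TYPE(bit) n)\<lparr>carrier := C\<rparr>"
  have sub: "VectorSpace.subspace class_ring C (module_vec TYPE(bit) n)"
    using assms by (simp add: subspace_bit_iff)
  interpret W: vectorspace class_ring ?W
    by (rule V.subspace_is_vs[OF sub])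
  have finC: "finite C"
    using assms finite_carrier_vec_bit finite_subset by (auto simp: add_closed_code_def)
  \<comment> \<open>The finite set \<open>C\<close> spans itself, which gives finite dimension and
    hence a basis.\<close>
  have "C \<subseteq> W.span C"
    using W.in_own_span[of C] by simp
  moreover have "W.span C \<subseteq> C"
    using W.span_is_subset2[of C] by simp
  ultimately have "W.fin_dim"
    unfolding W.fin_dim_def using finC by auto
  then obtain B where B: "finite B" "W.basis B"
    using W.finite_basis_exists by blast
  have BC: "B \<subseteq> carrier ?W"
    using B(2) by (simp add: W.basis_def)
  have uniq: "\<exists>!a. a \<in> B \<rightarrow>\<^sub>E (UNIV :: bit set) \<and> W.lincomb a B = v" if "v \<in> C" for v
    using W.basis_criterion[OF B(1) BC] B(2) that by auto
  have closed: "W.lincomb a B \<in> C" for a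
    using W.lincomb_closed[OF BC, of a] by simp
  have "bij_betw (\<lambda>a. W.lincomb a B) (B \<rightarrow>\<^sub>E (UNIV :: bit set)) C"
    unfolding bij_betw_def inj_on_def using uniq closed by blast
  then have "card C = card (B \<rightarrow>\<^sub>E (UNIV :: bit set))"
    by (simp add: bij_betw_same_card)
  also have "\<dots> = 2 ^ card B"
    using B(1) by (simp add: card_PiE card_UNIV_bit)
  finally show ?thesis
    using W.dim_basis[OF B] by simp
qed

lemma binary_code_iff:
  "binary_code n k C \<longleftrightarrow> add_closed_code n C \<and> card C = 2 ^ k"
  using card_bit_subspace[of n C] by (auto simp: binary_code_def subspace_bit_iff)

section \<open>Generating three-dimensional codes\<close>

definition adjoin :: "bit vec \<Rightarrow> bit vec set \<Rightarrow> bit vec set" where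
  "adjoin z S = S \<union> (\<lambda>s. s + z) ` S"

lemma add_closed_code_zero: "add_closed_code n {0\<^sub>v n}"
  by (simp add: add_closed_code_def)

text \<open>The translate of \<open>S\<close> by \<open>z\<close> is disjoint from \<open>S\<close>:
  a common element would make \<open>z\<close> a sum of two elements of \<open>S\<close>.\<close>

lemma adjoin_code:
  assumes S: "add_closed_code n S" and z: "z \<in> carrier_vec n" "z \<notin> S"
  shows "add_closed_code n (adjoin z S)" "card (adjoin z S) = 2 * card S"
proof -
  have SC: "\<And>u. u \<in> S \<Longrightarrow> u \<in> carrier_vec n" and S0: "0\<^sub>v n \<in> S"
    and Sadd: "\<And>u v. u \<in> S \<Longrightarrow> v \<in> S \<Longrightarrow> u + v \<in> S"
    using S by (auto simp: add_closed_code_def)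
  have 1: "(s + z) + t = (s + t) + z" "s + (t + z) = (s + t) + z" "(s + z) + (t + z) = s + t"
    if "s \<in> S" "t \<in> S" for s t
    using SC[OF that(1)] SC[OF that(2)] z(1) by (simp_all add: bit_vec_ac[where n = n])
  show "add_closed_code n (adjoin z S)"
    unfolding add_closed_code_def adjoin_def
    using SC S0 Sadd z(1) by (auto simp: 1)
  have "inj_on (\<lambda>s. s + z) S"
  proof (rule inj_onI)
    fix s t assume st: "s \<in> S" "t \<in> S" "s + z = t + z"
    have "s = z + (s + z)" "t = z + (t + z)"
      using SC[OF st(1)] SC[OF st(2)] z(1) by (simp_all add: bit_vec_ac[where n = n])
    then show "s = t" using st(3) by simp
  qed
  moreover have "S \<inter> (\<lambda>s. s + z) ` S = {}"
  proof -
    have False if "s \<in> S" "s + z \<in> S" for s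
    proof -
      have "s + (s + z) = z"
        using SC[OF that(1)] z(1) by (simp add: bit_vec_ac[where n = n])
      then show False using Sadd[OF that] z(2) by simp
    qed
    then show ?thesis by auto
  qed
  moreover have "finite S"
    using finite_subset[OF _ finite_carrier_vec_bit] SC by blast
  ultimately show "card (adjoin z S) = 2 * card S"
    by (simp add: adjoin_def card_Un_disjoint card_image)
qed

text \<open>The combinations with nonzero coefficient vector. That zero is not among them says
  exactly that the generators are linearly independent.\<close>

definition words :: "bit vec \<Rightarrow> bit vec \<Rightarrow> bit vec \<Rightarrow> bit vec set" where
  "words x y z = {x, y, x + y, z, x + z, y + z, x + y + z}"

lemma insert_zero_words_eq_adjoin:
  assumes "x \<in> carrier_vec n" "y \<in> carrier_vec n" "z \<in> carrier_vec n"
  shows "insert (0\<^sub>v n) (words x y z) = adjoin z (adjoin y (adjoin x {0\<^sub>v n}))"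
  using assms by (auto simp: words_def adjoin_def)

lemma words_code:
  assumes "x \<in> carrier_vec n" "y \<in> carrier_vec n" "z \<in> carrier_vec n"
    and nz: "0\<^sub>v n \<notin> words x y z"
  shows "add_closed_code n (insert (0\<^sub>v n) (words x y z))" "card (insert (0\<^sub>v n) (words x y z)) = 8"
proof -
  have x: "x \<notin> {0\<^sub>v n}" and y: "y \<notin> adjoin x {0\<^sub>v n}" and z: "z \<notin> adjoin y (adjoin x {0\<^sub>v n})"
    using assms by (auto simp: words_def adjoin_def bit_vec_add_self)
  note X = adjoin_code[OF add_closed_code_zero assms(1) x]
  note Y = adjoin_code[OF X(1) assms(2) y]
  note Z = adjoin_code[OF Y(1) assms(3) z]
  show "add_closed_code n (insert (0\<^sub>v n) (words x y z))" "card (insert (0\<^sub>v n) (words x y z)) = 8"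
    using X Y Z by (simp_all add: insert_zero_words_eq_adjoin assms(1-3))
qed

text \<open>Adjoining a word outside the current span doubles it, from 1 through 2 and 4 to 8
  elements, which exhausts \<open>C\<close>. The first generator is prescribed so that it can later
  be a word of odd weight.\<close>

lemma code_eq_words:
  assumes C: "add_closed_code n C" "card C = 8" and x: "x \<in> C" "x \<noteq> 0\<^sub>v n"
  obtains y z where "y \<in> C" "z \<in> C" "C = insert (0\<^sub>v n) (words x y z)" "0\<^sub>v n \<notin> words x y z"
proof -
  have CC: "\<And>u. u \<in> C \<Longrightarrow> u \<in> carrier_vec n" and C0: "0\<^sub>v n \<in> C"
    and Cadd: "\<And>u v. u \<in> C \<Longrightarrow> v \<in> C \<Longrightarrow> u + v \<in> C"
    using C by (auto simp: add_closed_code_def)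
  have finC: "finite C" using C(2) card.infinite by fastforce
  have sub: "adjoin u S \<subseteq> C" if "u \<in> C" "S \<subseteq> C" for u S
    using that Cadd by (auto simp: adjoin_def)
  have more: "\<exists>u. u \<in> C \<and> u \<notin> S" if "S \<subseteq> C" "card S < 8" for S
    using that C(2) by (metis less_irrefl subsetI subset_antisym)
  let ?X = "adjoin x {0\<^sub>v n}"
  have X: "add_closed_code n ?X" "card ?X = 2"
    using adjoin_code[OF add_closed_code_zero CC[OF x(1)]] x(2) by auto
  have XC: "?X \<subseteq> C" using sub[OF x(1)] C0 by simp
  obtain y where y: "y \<in> C" "y \<notin> ?X" using more[OF XC] X(2) by auto
  let ?Y = "adjoin y ?X"
  have Y: "add_closed_code n ?Y" "card ?Y = 4"
    using adjoin_code[OF X(1) CC[OF y(1)] y(2)] X(2) by auto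
  have YC: "?Y \<subseteq> C" using sub[OF y(1) XC] .
  obtain z where z: "z \<in> C" "z \<notin> ?Y" using more[OF YC] Y(2) by auto
  let ?Z = "adjoin z ?Y"
  have Z: "card ?Z = 8"
    using adjoin_code[OF Y(1) CC[OF z(1)] z(2)] Y(2) by auto
  have ZC: "?Z \<subseteq> C" using sub[OF z(1) YC] .
  have "C = ?Z" using card_subset_eq[OF finC ZC] Z C(2) by simp
  then have eq: "C = insert (0\<^sub>v n) (words x y z)"
    using insert_zero_words_eq_adjoin[OF CC[OF x(1)] CC[OF y(1)] CC[OF z(1)]] by simp
  have "0\<^sub>v n \<notin> words x y z"
  proof
    assume "0\<^sub>v n \<in> words x y z"
    then have "C = set [x, y, x + y, z, x + z, y + z, x + y + z]"
      using eq by (auto simp: words_def)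
    then have "card C \<le> 7"
      using card_length[of "[x, y, x + y, z, x + z, y + z, x + y + z]"] by simp
    then show False using C(2) by simp
  qed
  then show ?thesis using that y(1) z(1) eq by blast
qed

section \<open>Weights and inner products\<close>

lemma of_nat_bit_eq_0_iff: "of_nat m = (0 :: bit) \<longleftrightarrow> even m"
  using even_of_nat[of m, where 'a = bit] by (cases "of_nat m :: bit") auto

lemma hamming_weight_eq_sum:
  "v \<in> carrier_vec n \<Longrightarrow> hamming_weight v = (\<Sum>i<n. of_bool (v $ i = 1))"
  by (simp add: hamming_weight_def of_bool_def sum.If_cases lessThan_def Int_def)

text \<open>Bits are idempotent, so \<open>v \<bullet> v\<close> is the sum of the entries.\<close>

lemma of_nat_hamming_weight:
  assumes "v \<in> carrier_vec n"
  shows "of_nat (hamming_weight v) = v \<bullet> v"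
proof -
  have "(of_nat (\<Sum>i<n. of_bool (v $ i = 1)) :: bit) = (\<Sum>i<n. v $ i * v $ i)"
    unfolding of_nat_sum by (rule sum.cong) (auto simp: of_bool_def)
  then show ?thesis
    using assms by (simp add: hamming_weight_eq_sum scalar_prod_def atLeast0LessThan)
qed

text \<open>Here \<open>m\<close> is the size of the common support, whose coordinates cancel in
  \<open>u + v\<close>.\<close>

lemma hamming_weight_add:
  assumes "u \<in> carrier_vec n" "v \<in> carrier_vec n"
  obtains m where "hamming_weight u + hamming_weight v = hamming_weight (u + v) + 2 * m"
    "u \<bullet> v = of_nat m"
proof
  let ?m = "\<Sum>i<n. of_bool (u $ i = 1 \<and> v $ i = 1) :: nat"
  have "(of_bool (u $ i = 1) + of_bool (v $ i = 1) :: nat) =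
      of_bool ((u + v) $ i = 1) + 2 * of_bool (u $ i = 1 \<and> v $ i = 1)" if "i < n" for i
    using assms that by (cases "u $ i"; cases "v $ i") auto
  then show "hamming_weight u + hamming_weight v = hamming_weight (u + v) + 2 * ?m"
    unfolding hamming_weight_eq_sum[OF assms(1)] hamming_weight_eq_sum[OF assms(2)]
      hamming_weight_eq_sum[OF add_carrier_vec[OF assms]] sum_distrib_left sum.distrib[symmetric]
    by (intro sum.cong) auto
  have "(of_nat ?m :: bit) = (\<Sum>i<n. u $ i * v $ i)"
    unfolding of_nat_sum by (rule sum.cong) (auto simp: of_bool_def)
  then show "u \<bullet> v = of_nat ?m"
    using assms by (simp add: scalar_prod_def atLeast0LessThan)
qed

text \<open>The three bits at a coordinate define a linear functional on coefficient vectors, which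
  is 1 on four of them unless it is zero.\<close>

lemma sum_weights_words:
  assumes "x \<in> carrier_vec n" "y \<in> carrier_vec n" "z \<in> carrier_vec n"
  shows "hamming_weight x + hamming_weight y + hamming_weight (x + y) + hamming_weight z
    + hamming_weight (x + z) + hamming_weight (y + z) + hamming_weight (x + y + z) \<le> 4 * n"
proof -
  have "(of_bool (x $ i = 1) + of_bool (y $ i = 1) + of_bool ((x + y) $ i = 1) + of_bool (z $ i = 1)
    + of_bool ((x + z) $ i = 1) + of_bool ((y + z) $ i = 1) + of_bool ((x + y + z) $ i = 1) :: nat) \<le> 4"
    if "i < n" for i
    using assms that by (cases "x $ i"; cases "y $ i"; cases "z $ i") auto
  then have "(\<Sum>i<n. of_bool (x $ i = 1) + of_bool (y $ i = 1) + of_bool ((x + y) $ i = 1)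
    + of_bool (z $ i = 1) + of_bool ((x + z) $ i = 1) + of_bool ((y + z) $ i = 1)
    + of_bool ((x + y + z) $ i = 1) :: nat) \<le> (\<Sum>i<n. 4)"
    by (intro sum_mono) auto
  then show ?thesis
    using assms by (simp add: hamming_weight_eq_sum[of _ n] sum.distrib)
qed

text \<open>By bilinearity, orthogonality to the code need only be tested on the generators.\<close>

lemma LCD_words_iff:
  assumes xyz: "x \<in> carrier_vec n" "y \<in> carrier_vec n" "z \<in> carrier_vec n"
    and nz: "0\<^sub>v n \<notin> words x y z"
  shows "LCD n (insert (0\<^sub>v n) (words x y z)) \<longleftrightarrow>
    (\<forall>w \<in> words x y z. \<not> (w \<bullet> x = 0 \<and> w \<bullet> y = 0 \<and> w \<bullet> z = 0))"
proof -
  have orth: "(\<forall>v \<in> insert (0\<^sub>v n) (words x y z). w \<bullet> v = 0) \<longleftrightarrow> w \<bullet> x = 0 \<and> w \<bullet> y = 0 \<and> w \<bullet> z = 0"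
    if "w \<in> carrier_vec n" for w
    using that xyz by (auto simp: words_def scalar_prod_add_distrib[of _ n])
  have carr: "w \<in> carrier_vec n" if "w \<in> words x y z" for w
    using that xyz by (auto simp: words_def)
  have "insert (0\<^sub>v n) (words x y z) \<inter> vec_module.orthogonal_complement n (insert (0\<^sub>v n) (words x y z))
    = insert (0\<^sub>v n) {w \<in> words x y z. w \<bullet> x = 0 \<and> w \<bullet> y = 0 \<and> w \<bullet> z = 0}"
    unfolding vec_module.orthogonal_complement_def using carr orth xyz
    by (auto simp del: insert_iff simp: insert_iff[of _ "0\<^sub>v n"])
  then show ?thesis
    unfolding LCD_def using nz by auto
qed

section \<open>Parity structure of LCD codes\<close>

lemma LCD_has_odd_word:
  assumes C: "add_closed_code n C" "card C = 8" "LCD n C"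
  obtains (odd) z where "z \<in> C" "odd (hamming_weight z)"
proof -
  have CC: "\<And>u. u \<in> C \<Longrightarrow> u \<in> carrier_vec n"
    using C by (auto simp: add_closed_code_def)
  have "\<not> C \<subseteq> {0\<^sub>v n}"
    using C(2) card_mono[of "{0\<^sub>v n}" C] by auto
  then obtain x where "x \<in> C" "x \<noteq> 0\<^sub>v n" by auto
  then obtain y z where yz: "y \<in> C" "z \<in> C" and eq: "C = insert (0\<^sub>v n) (words x y z)"
    and nz: "0\<^sub>v n \<notin> words x y z"
    using code_eq_words[OF C(1,2)] by blast
  note c = CC[OF \<open>x \<in> C\<close>] CC[OF yz(1)] CC[OF yz(2)]
  have L: "\<And>w. w \<in> words x y z \<Longrightarrow> w \<bullet> x = 0 \<Longrightarrow> w \<bullet> y = 0 \<Longrightarrow> w \<bullet> z = 0 \<Longrightarrow> False"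
    using C(3) unfolding eq LCD_words_iff[OF c nz] by blast
  show thesis
  proof (rule ccontr)
    assume "\<not> thesis"
    then have "even (hamming_weight w)" if "w \<in> C" for w
      using that odd by blast
    then have self: "w \<bullet> w = 0" if "w \<in> C" for w
      using that of_nat_hamming_weight[OF CC[OF that]] of_nat_bit_eq_0_iff by metis
    note s = self[OF \<open>x \<in> C\<close>] self[OF yz(1)] self[OF yz(2)]
    have sym: "y \<bullet> x = x \<bullet> y" "z \<bullet> x = x \<bullet> z" "z \<bullet> y = y \<bullet> z"
      using c by (simp_all add: comm_scalar_prod[of _ n])
    \<comment> \<open>With \<open>a = x \<bullet> y\<close>, \<open>b = x \<bullet> z\<close>, \<open>c = y \<bullet> z\<close>, the word \<open>c x + b y + a z\<close> lies in the radical
      (and every word does if \<open>a = b = c = 0\<close>).\<close>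
    show False
      using L[of x] L[of y] L[of z] L[of "x + y"] L[of "x + z"] L[of "y + z"] L[of "x + y + z"] c s sym
      by (cases "x \<bullet> y"; cases "x \<bullet> z"; cases "y \<bullet> z")
        (simp_all add: words_def add_scalar_prod_distrib[of _ n])
  qed
qed

lemma even_hamming_weight_add:
  assumes "u \<in> carrier_vec n" "v \<in> carrier_vec n"
  shows "even (hamming_weight (u + v)) \<longleftrightarrow> (even (hamming_weight u) \<longleftrightarrow> even (hamming_weight v))"
  using hamming_weight_add[OF assms] by (metis even_add even_mult_iff even_numeral)

text \<open>Generators adapted to parity: \<open>u\<close>, \<open>v\<close>, \<open>u + v\<close>
  are the even words, and adding \<open>z\<close> to them or to zero gives the odd ones.\<close>

lemma LCD_code_eq_words_even_odd:
  assumes C: "add_closed_code n C" "card C = 8" "LCD n C"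
  obtains u v z where "words u v z = C - {0\<^sub>v n}"
    "u \<in> carrier_vec n" "v \<in> carrier_vec n" "z \<in> carrier_vec n"
    "even (hamming_weight u)" "even (hamming_weight v)" "odd (hamming_weight z)"
proof -
  have CC: "\<And>u. u \<in> C \<Longrightarrow> u \<in> carrier_vec n"
    using C by (auto simp: add_closed_code_def)
  obtain z where z: "z \<in> C" "odd (hamming_weight z)"
    using LCD_has_odd_word[OF C] .
  have "z \<noteq> 0\<^sub>v n"
    using z(2) by (auto simp: hamming_weight_eq_sum[OF zero_carrier_vec])
  then obtain x y where xy: "x \<in> C" "y \<in> C" and eq: "C = insert (0\<^sub>v n) (words z x y)"
    and nz: "0\<^sub>v n \<notin> words z x y"
    using code_eq_words[OF C(1,2) z(1)] by metis
  note c = CC[OF z(1)] CC[OF xy(1)] CC[OF xy(2)]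
  \<comment> \<open>Adding the odd word \<open>z\<close> repairs an odd parity and leaves the set of
    seven words unchanged.\<close>
  define u where "u = (if even (hamming_weight x) then x else x + z)"
  define v where "v = (if even (hamming_weight y) then y else y + z)"
  have "words u v z = words z x y"
    using c unfolding u_def v_def words_def by (auto simp: bit_vec_ac[where n = n])
  moreover have "words z x y = C - {0\<^sub>v n}" using eq nz by auto
  moreover have "u \<in> carrier_vec n" "v \<in> carrier_vec n" using c by (auto simp: u_def v_def)
  moreover have "even (hamming_weight u)" "even (hamming_weight v)"
    using c z(2) by (auto simp: u_def v_def even_hamming_weight_add[of _ n])
  ultimately show ?thesis using that c z(2) by blast
qed

text \<open>Weights \<open>4 * m\<close> force \<open>u\<close> and \<open>v\<close> to overlap in
  \<open>2 * m\<close> places, so their span is totally isotropic.\<close>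

lemma LCD_even_plane:
  assumes "u \<in> carrier_vec n" "v \<in> carrier_vec n" "z \<in> carrier_vec n"
    and nz: "0\<^sub>v n \<notin> words u v z" and LCD: "LCD n (insert (0\<^sub>v n) (words u v z))"
  shows "\<not> (hamming_weight u = 4 * m \<and> hamming_weight v = 4 * m \<and> hamming_weight (u + v) = 4 * m)"
proof
  assume w: "hamming_weight u = 4 * m \<and> hamming_weight v = 4 * m \<and> hamming_weight (u + v) = 4 * m"
  have uu: "u \<bullet> u = 0" "v \<bullet> v = 0"
    using w of_nat_hamming_weight[OF assms(1)] of_nat_hamming_weight[OF assms(2)]
      of_nat_bit_eq_0_iff[of "4 * m"] by (metis dvd_mult2 even_numeral)+
  obtain k where "hamming_weight u + hamming_weight v = hamming_weight (u + v) + 2 * k"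
    "u \<bullet> v = of_nat k"
    using hamming_weight_add[OF assms(1,2)] .
  then have uv: "u \<bullet> v = 0"
    using w by (auto simp: of_nat_bit_eq_0_iff)
  have vu: "v \<bullet> u = 0"
    using uv assms(1,2) by (simp add: comm_scalar_prod[of _ n])
  have L: "\<And>w. w \<in> words u v z \<Longrightarrow> w \<bullet> u = 0 \<Longrightarrow> w \<bullet> v = 0 \<Longrightarrow> w \<bullet> z = 0 \<Longrightarrow> False"
    using LCD unfolding LCD_words_iff[OF assms(1-4)] by blast
  \<comment> \<open>The inner product with \<open>z\<close> is a linear functional on the plane, so
    it vanishes at one of \<open>u\<close>, \<open>v\<close>, \<open>u + v\<close>, which then lies
    in the radical.\<close>
  show False
    using L[of u] L[of v] L[of "u + v"] uu uv vu assms(1-3)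
    by (cases "u \<bullet> z"; cases "v \<bullet> z") (simp_all add: words_def add_scalar_prod_distrib[of _ n])
qed

section \<open>Counting weights for the upper bound\<close>

definition LCD_bound :: "nat \<Rightarrow> nat" where
  "LCD_bound n = (if n mod 7 = 3 \<or> n mod 7 = 5 then 4 * n div 7 else 4 * n div 7 - 1)"

lemma LCD_bound_seven:
  "r < 7 \<Longrightarrow> LCD_bound (7 * q + r) = 4 * q + 4 * r div 7 - (if r = 3 \<or> r = 5 then 0 else 1)"
proof -
  assume "r < 7"
  have "4 * (7 * q + r) = 4 * r + 7 * (4 * q)" by simp
  then have "4 * (7 * q + r) div 7 = 4 * q + 4 * r div 7"
    by (metis add.commute div_mult_self2 zero_neq_numeral)
  then show ?thesis using \<open>r < 7\<close> by (simp add: LCD_bound_def)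
qed

text \<open>Were \<open>k\<close> above the bound, rounding each weight up to its parity would make
  the total exceed \<open>4 * n\<close>, or meet it exactly for residues 1 and 6, where
  \<open>plane\<close> applies.\<close>

lemma le_LCD_bound_of_weights:
  fixes a b c d e f g :: nat
  assumes "n \<ge> 3" and ev: "even a" "even b" "even c" and od: "odd d" "odd e" "odd f" "odd g"
    and sum: "a + b + c + d + e + f + g \<le> 4 * n"
    and plane: "\<And>m. \<not> (a = 4 * m \<and> b = 4 * m \<and> c = 4 * m)"
    and low: "\<forall>w \<in> {a, b, c, d, e, f, g}. k \<le> w"
  shows "k \<le> LCD_bound n"
proof (rule ccontr)
  assume "\<not> k \<le> LCD_bound n"
  define q r where "q = n div 7" and "r = n mod 7"
  have n: "n = 7 * q + r" and r: "r < 7" by (auto simp: q_def r_def)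
  obtain a' b' c' where A: "a = 2 * a'" "b = 2 * b'" "c = 2 * c'"
    using ev by (auto elim!: evenE)
  obtain d' e' f' g' where D: "d = 2 * d' + 1" "e = 2 * e' + 1" "f = 2 * f' + 1" "g = 2 * g' + 1"
    using od by (auto elim!: oddE)
  \<comment> \<open>One more than \<open>LCD_bound n\<close>, the least value of \<open>k\<close> to
    be refuted.\<close>
  define t where "t = (if r = 3 \<or> r = 5 then 4 * q + 4 * r div 7 + 1 else 4 * q + 4 * r div 7)"
  have "t \<le> k"
    using \<open>\<not> k \<le> LCD_bound n\<close> LCD_bound_seven[OF r, of q] n \<open>n \<ge> 3\<close> by (auto simp: t_def split: if_splits)
  then have w: "t \<le> 2 * a'" "t \<le> 2 * b'" "t \<le> 2 * c'"
      "t \<le> 2 * d' + 1" "t \<le> 2 * e' + 1" "t \<le> 2 * f' + 1" "t \<le> 2 * g' + 1"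
    using low A D by auto
  have s: "2 * a' + 2 * b' + 2 * c' + 2 * d' + 2 * e' + 2 * f' + 2 * g' + 4 \<le> 28 * q + 4 * r"
    using sum A D n by simp
  \<comment> \<open>The even weights forced for residues 1 and 6 are \<open>4 * q\<close> and
    \<open>4 * (q + 1)\<close>.\<close>
  have p1: "\<not> (a' = 2 * q \<and> b' = 2 * q \<and> c' = 2 * q)"
    using plane[of q] A by simp
  have p2: "\<not> (a' = 2 * q + 2 \<and> b' = 2 * q + 2 \<and> c' = 2 * q + 2)"
    using plane[of "q + 1"] A by auto
  \<comment> \<open>The least \<open>a'\<close> with \<open>t \<le> 2 * a'\<close> and the least
    \<open>d'\<close> with \<open>t \<le> 2 * d' + 1\<close>.\<close>
  define \<alpha> \<beta> where "\<alpha> = (t + 1) div 2" and "\<beta> = t div 2"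
  have \<alpha>: "\<alpha> \<le> a'" "\<alpha> \<le> b'" "\<alpha> \<le> c'" and "\<beta> \<le> d'" "\<beta> \<le> e'" "\<beta> \<le> f'" "\<beta> \<le> g'"
    using w by (auto simp: \<alpha>_def \<beta>_def)
  then have s': "6 * \<alpha> + 8 * \<beta> + 4 + 2 * (a' - \<alpha>) + 2 * (b' - \<alpha>) + 2 * (c' - \<alpha>) \<le> 28 * q + 4 * r"
    using s by linarith
  consider "r = 0" | "r = 1" | "r = 2" | "r = 3" | "r = 4" | "r = 5" | "r = 6"
    using r by linarith
  then show False
  proof cases
    \<comment> \<open>The minimal total is \<open>28 * q + 4\<close>, which equals
      \<open>4 * n\<close>, so the even weights have no slack; likewise for residue 6 with
      \<open>28 * q + 24\<close>. In all other cases the minimal total is already too large.\<close>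
    case 2
    then have "\<alpha> = 2 * q" "\<beta> = 2 * q" by (simp_all add: \<alpha>_def \<beta>_def t_def)
    then show ?thesis using s' \<alpha> 2 p1 by linarith
  next
    case 7
    then have "\<alpha> = 2 * q + 2" "\<beta> = 2 * q + 1" by (simp_all add: \<alpha>_def \<beta>_def t_def)
    then show ?thesis using s' \<alpha> 7 p2 by linarith
  qed (use s' in \<open>simp_all add: \<alpha>_def \<beta>_def t_def\<close>)
qed

lemma LCD_min_weight_le:
  assumes "n \<ge> 3" and C: "binary_code n 3 C" "LCD n C"
  shows "min_weight n C \<le> LCD_bound n"
proof -
  have C': "add_closed_code n C" "card C = 8"
    using C(1) by (auto simp: binary_code_iff)
  obtain u v z where W: "words u v z = C - {0\<^sub>v n}"
    and c: "u \<in> carrier_vec n" "v \<in> carrier_vec n" "z \<in> carrier_vec n"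
    and p: "even (hamming_weight u)" "even (hamming_weight v)" "odd (hamming_weight z)"
    using LCD_code_eq_words_even_odd[OF C' C(2)] .
  have nz: "0\<^sub>v n \<notin> words u v z" and eq: "C = insert (0\<^sub>v n) (words u v z)"
    using W C'(1) by (auto simp: add_closed_code_def)
  have low: "min_weight n C \<le> hamming_weight w" if "w \<in> words u v z" for w
    unfolding min_weight_def W[symmetric] using that by (intro Min_le) (auto simp: words_def)
  show ?thesis
  proof (rule le_LCD_bound_of_weights[OF \<open>n \<ge> 3\<close> _ _ _ _ _ _ _ sum_weights_words[OF c]])
    show "\<not> (hamming_weight u = 4 * m \<and> hamming_weight v = 4 * m \<and> hamming_weight (u + v) = 4 * m)" for m
      using LCD_even_plane[OF c nz] C(2) eq by simp
  qed (use p c low in \<open>auto simp: even_hamming_weight_add[of _ n] words_def\<close>)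
qed

section \<open>Codes attaining the bound\<close>

lemma hamming_weight_list: "hamming_weight v = length (filter (\<lambda>b. b = 1) (list_of_vec v))"
  by (simp add: hamming_weight_def length_filter_conv_card list_of_vec_index)

lemma hamming_weight_append: "hamming_weight (v @\<^sub>v w) = hamming_weight v + hamming_weight w"
  by (simp add: hamming_weight_list)

lemma vec_of_list_add:
  "length xs = length ys \<Longrightarrow> vec_of_list xs + vec_of_list ys = vec_of_list (map2 (+) xs ys)"
  by (rule eq_vecI) (auto simp: vec_of_list_index)

lemma vec_of_list_scalar_prod:
  "length xs = length ys \<Longrightarrow> vec_of_list xs \<bullet> vec_of_list ys = sum_list (map2 (*) xs ys)"
  by (simp add: scalar_prod_def vec_of_list_index sum_list_sum_nth)

text \<open>Independence is implicit: a zero word would be orthogonal to all generators.\<close>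

definition LCD_generators :: "nat \<Rightarrow> nat \<Rightarrow> bit vec \<Rightarrow> bit vec \<Rightarrow> bit vec \<Rightarrow> bool" where
  "LCD_generators n d x y z \<longleftrightarrow> x \<in> carrier_vec n \<and> y \<in> carrier_vec n \<and> z \<in> carrier_vec n \<and>
    (\<forall>w \<in> words x y z. d \<le> hamming_weight w \<and> \<not> (w \<bullet> x = 0 \<and> w \<bullet> y = 0 \<and> w \<bullet> z = 0))"

definition LCD_achieves :: "nat \<Rightarrow> nat \<Rightarrow> bool" where
  "LCD_achieves n d \<longleftrightarrow> (\<exists>x y z. LCD_generators n d x y z)"

text \<open>Dependent generators are allowed, so that a single zero coordinate is a block with
  \<open>e = 0\<close>.\<close>

definition self_orthogonal_block :: "nat \<Rightarrow> nat \<Rightarrow> bit vec \<Rightarrow> bit vec \<Rightarrow> bit vec \<Rightarrow> bool" where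
  "self_orthogonal_block m e r s t \<longleftrightarrow> r \<in> carrier_vec m \<and> s \<in> carrier_vec m \<and> t \<in> carrier_vec m \<and>
    (\<forall>w \<in> words r s t. e \<le> hamming_weight w \<and> w \<bullet> r = 0 \<and> w \<bullet> s = 0 \<and> w \<bullet> t = 0)"

text \<open>Each new word is an old word followed by a word of the block, which adds at least
  \<open>e\<close> to the weight and nothing to the inner products.\<close>

lemma LCD_generators_append:
  assumes "LCD_generators n d x y z" "self_orthogonal_block m e r s t"
  shows "LCD_generators (n + m) (d + e) (x @\<^sub>v r) (y @\<^sub>v s) (z @\<^sub>v t)"
proof -
  have c: "x \<in> carrier_vec n" "y \<in> carrier_vec n" "z \<in> carrier_vec n"
    "r \<in> carrier_vec m" "s \<in> carrier_vec m" "t \<in> carrier_vec m"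
    using assms by (auto simp: LCD_generators_def self_orthogonal_block_def)
  have "\<exists>v \<in> words x y z. \<exists>b \<in> words r s t. w = v @\<^sub>v b"
    if "w \<in> words (x @\<^sub>v r) (y @\<^sub>v s) (z @\<^sub>v t)" for w
    using that c unfolding words_def
    by (auto simp: append_vec_add[where n = n and m = m])
  moreover have "v \<in> carrier_vec n" if "v \<in> words x y z" for v
    using that c by (auto simp: words_def)
  moreover have "b \<in> carrier_vec m" if "b \<in> words r s t" for b
    using that c by (auto simp: words_def)
  ultimately show ?thesis
    using assms c unfolding LCD_generators_def self_orthogonal_block_def
    by (fastforce simp: hamming_weight_append scalar_prod_append[where ?n1.0 = n and ?n2.0 = m]
        intro: add_mono)
qed

text \<open>The columns are the numbers 1 to 7 in binary. Without \<open>vec_of_list_Cons\<close>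
  the vectors keep their list form, on which everything is evaluated.\<close>

lemma simplex_block:
  "self_orthogonal_block 7 4 (vec_of_list [0,0,0,1,1,1,1]) (vec_of_list [0,1,1,0,0,1,1])
    (vec_of_list [1,0,1,0,1,0,1])"
  by (simp add: self_orthogonal_block_def words_def vec_of_list_add vec_of_list_scalar_prod
      hamming_weight_list list_vec carrier_vecI del: vec_of_list_Cons)

lemma zero_block: "self_orthogonal_block 1 0 (0\<^sub>v 1) (0\<^sub>v 1) (0\<^sub>v 1)"
  by (simp add: self_orthogonal_block_def words_def)

lemma LCD_achieves_add_7: "LCD_achieves n d \<Longrightarrow> LCD_achieves (n + 7) (d + 4)"
  unfolding LCD_achieves_def using LCD_generators_append[OF _ simplex_block] by blast

lemma LCD_achieves_Suc: "LCD_achieves n d \<Longrightarrow> LCD_achieves (Suc n) d"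
  unfolding LCD_achieves_def using LCD_generators_append[OF _ zero_block] by fastforce

lemma LCD_achieves_add_mult_7: "LCD_achieves n d \<Longrightarrow> LCD_achieves (7 * q + n) (4 * q + d)"
proof (induction q)
  case (Suc q)
  then show ?case using LCD_achieves_add_7[of "7 * q + n" "4 * q + d"] by (simp add: algebra_simps)
qed simp

text \<open>These are the values of \<open>LCD_bound\<close>. They serve residues 3, 5, 0, 2
  directly and 4, 6, 1 after appending a zero coordinate to lengths 3, 5, 7.\<close>

lemma LCD_achieves_small: "LCD_achieves 3 1" "LCD_achieves 5 2" "LCD_achieves 7 3" "LCD_achieves 9 4"
proof -
  note s = LCD_generators_def words_def vec_of_list_add vec_of_list_scalar_prod
    hamming_weight_list list_vec carrier_vecI
  have "LCD_generators 3 1 (vec_of_list [0,0,1]) (vec_of_list [0,1,0]) (vec_of_list [1,0,0])"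
    by (simp add: s del: vec_of_list_Cons)
  moreover have "LCD_generators 5 2 (vec_of_list [0,0,0,1,1]) (vec_of_list [0,0,1,0,1]) (vec_of_list [1,1,0,0,1])"
    by (simp add: s del: vec_of_list_Cons)
  moreover have "LCD_generators 7 3 (vec_of_list [0,0,0,0,1,1,1]) (vec_of_list [0,0,1,1,0,0,1])
      (vec_of_list [1,1,0,0,0,1,0])"
    by (simp add: s del: vec_of_list_Cons)
  moreover have "LCD_generators 9 4 (vec_of_list [0,0,0,0,0,1,1,1,1]) (vec_of_list [0,0,1,1,1,0,0,0,1])
      (vec_of_list [1,1,0,0,1,0,0,1,1])"
    by (simp add: s del: vec_of_list_Cons)
  ultimately show "LCD_achieves 3 1" "LCD_achieves 5 2" "LCD_achieves 7 3" "LCD_achieves 9 4"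
    by (auto simp: LCD_achieves_def)
qed

lemma LCD_achieves_bound:
  assumes "n \<ge> 3"
  shows "LCD_achieves n (LCD_bound n)"
proof -
  define q r where "q = n div 7" and "r = n mod 7"
  have n: "n = 7 * q + r" and r: "r < 7" by (auto simp: q_def r_def)
  \<comment> \<open>Residues 0, 1, 2 start from length 7 or 9, which already uses up one block of
    seven.\<close>
  have q: "\<exists>p. q = Suc p" if "r < 3"
    using assms n that by (cases q) auto
  note add = LCD_achieves_add_mult_7[OF LCD_achieves_small(1), of q]
    LCD_achieves_add_mult_7[OF LCD_achieves_small(2), of q]
  note add' = LCD_achieves_add_mult_7[OF LCD_achieves_small(3)] LCD_achieves_add_mult_7[OF LCD_achieves_small(4)]
  consider "r = 0" | "r = 1" | "r = 2" | "r = 3" | "r = 4" | "r = 5" | "r = 6"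
    using r by linarith
  then show ?thesis
  proof cases
    case 1
    then obtain p where "q = Suc p" using q by auto
    then show ?thesis
      using 1 add'(1)[of p] LCD_bound_seven[OF r, of q] n by (simp add: algebra_simps)
  next
    case 2
    then obtain p where "q = Suc p" using q by auto
    then show ?thesis
      using 2 LCD_achieves_Suc[OF add'(1)[of p]] LCD_bound_seven[OF r, of q] n by (simp add: algebra_simps)
  next
    case 3
    then obtain p where "q = Suc p" using q by auto
    then show ?thesis
      using 3 add'(2)[of p] LCD_bound_seven[OF r, of q] n by (simp add: algebra_simps)
  next
    case 5
    then show ?thesis
      using LCD_achieves_Suc[OF add(1)] LCD_bound_seven[OF r, of q] n by (simp add: algebra_simps)
  next
    case 7
    then show ?thesis
      using LCD_achieves_Suc[OF add(2)] LCD_bound_seven[OF r, of q] n by (simp add: algebra_simps)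
  qed (use add LCD_bound_seven[OF r, of q] n in simp_all)
qed

section \<open>Evaluating the maximum\<close>

lemma LCD_generators_code:
  assumes "LCD_generators n d x y z"
  shows "binary_code n 3 (insert (0\<^sub>v n) (words x y z))" "LCD n (insert (0\<^sub>v n) (words x y z))"
    "d \<le> min_weight n (insert (0\<^sub>v n) (words x y z))"
proof -
  have c: "x \<in> carrier_vec n" "y \<in> carrier_vec n" "z \<in> carrier_vec n"
    and w: "\<And>w. w \<in> words x y z \<Longrightarrow> d \<le> hamming_weight w"
    and L: "\<forall>w \<in> words x y z. \<not> (w \<bullet> x = 0 \<and> w \<bullet> y = 0 \<and> w \<bullet> z = 0)"
    using assms by (auto simp: LCD_generators_def)
  have nz: "0\<^sub>v n \<notin> words x y z"
    using L c by auto
  show "binary_code n 3 (insert (0\<^sub>v n) (words x y z))"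
    using words_code[OF c nz] by (simp add: binary_code_iff)
  show "LCD n (insert (0\<^sub>v n) (words x y z))"
    using LCD_words_iff[OF c nz] L by simp
  have "insert (0\<^sub>v n) (words x y z) - {0\<^sub>v n} = words x y z" using nz by auto
  then show "d \<le> min_weight n (insert (0\<^sub>v n) (words x y z))"
    unfolding min_weight_def using w by (subst Min_ge_iff) (auto simp: words_def)
qed

theorem theorem5p1:
  fixes n :: nat
  assumes "n \<ge> 3"
  shows "int (max_LCD_weight n 3) =
    (if n mod 7 = 3 \<or> n mod 7 = 5 then \<lfloor>4 * real n / 7\<rfloor> else \<lfloor>4 * real n / 7\<rfloor> - 1)"
proof -
  obtain x y z where "LCD_generators n (LCD_bound n) x y z"
    using LCD_achieves_bound[OF assms] by (auto simp: LCD_achieves_def)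
  note G = LCD_generators_code[OF this]
  let ?M = "{min_weight n C | C. binary_code n 3 C \<and> LCD n C}"
  have le: "m \<le> LCD_bound n" if "m \<in> ?M" for m
    using that LCD_min_weight_le[OF assms] by blast
  \<comment> \<open>The constructed code has minimum weight at least the bound, and the upper bound
    forces equality.\<close>
  have "LCD_bound n \<in> ?M"
    using G LCD_min_weight_le[OF assms G(1,2)] by (metis (mono_tags, lifting) le_antisym mem_Collect_eq)
  moreover have "finite ?M"
    using le by (meson finite_nat_set_iff_bounded_le)
  ultimately have "max_LCD_weight n 3 = LCD_bound n"
    unfolding max_LCD_weight_def using le by (intro Max_eqI) auto
  moreover have "\<lfloor>4 * real n / 7\<rfloor> = int (4 * n div 7)"
    using floor_divide_of_nat_eq[of "4 * n" 7, where 'a = real] by simp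
  \<comment> \<open>This makes the truncated subtraction in \<open>LCD_bound\<close> agree with the
    integer one.\<close>
  moreover have "4 * n div 7 \<ge> 1" using assms by simp
  ultimately show ?thesis by (simp add: LCD_bound_def of_nat_diff)
qed

end
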